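(* Let $(\mathcal{A},\mathcal{E})$ be an AIS-category. Let $X$, $Y'$ and $Y''$ be three $\mathcal{E}$-subobjects of an object $Z$, with an admissible monic $Y'\to Y''$ compatible with the admissible monics $Y'\to Z$ and $Y''\to Z$. Then the following is an admissible short exact sequence: $$Y'\cap_Z X \rightarrowtail Y' \twoheadrightarrow (Y'+_Z X)/X,$$ where the first morphism is the pull-back projection and the second is the composite of the canonical morphisms $Y'\to Y'+_Z X\to (Y'+_Z X)/X$.
   Context: In an exact category $(\mathcal{A},\mathcal{E})$ (additive category with a Quillen exact structure), the pairs $(i,d)\in\mathcal{E}$ are called admissible short exact sequences, $i$ is called an admissible monic ($\rightarrowtail$) and $d$ an admissible epic ($\twoheadrightarrow$). An $\mathcal{E}$-subobject of $Z$ is an object $A$ together with an admissible monic $A\to Z$. For an admissible monic $i:A\to B$, $B/A$ denotes the cokernel of $i$. An exact category $(\mathcal{A},\mathcal{E})$ is an AIS-category if it satisfies the axiom (AIS): for any two admissible monics $j:C\to D$ and $g:B\to D$, their pull-back $A$ exists and yields two admissible monics $i:A\to B$ and $f:A\to C$ (with $g\circ i=j\circ f$); and moreover, if $E$ is the push-out of $i$ and $f$, with morphisms $l:B\to E$ and $k:C\to E$, then the unique morphism $u:E\to D$ with $u\circ l=g$ and $u\circ k=j$ is an admissible monic. For two $\mathcal{E}$-subobjects $(X_1,i_1)$, $(X_2,i_2)$ of $Z$, the intersection $X_1\cap_Z X_2$ is the pull-back of $i_1$ and $i_2$, and the sum $X_1+_Z X_2$ is the push-out of the two projections $X_1\cap_Z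 X_2\to X_1$, $X_1\cap_Z X_2\to X_2$. The quotient $(Y'+_Z X)/X$ is taken along the push-out morphism $X\to Y'+_Z X$, which is an admissible monic. *)

theory Defs
  imports "HOL-Algebra.Group"
begin

section \<open>Categories and additive categories\<close>

record ('o, 'm) cat =
  Obj :: "'o set"
  Arr :: "'m set"
  Dom :: "'m \<Rightarrow> 'o"
  Cod :: "'m \<Rightarrow> 'o"
  Ident :: "'o \<Rightarrow> 'm"
  Comp :: "'m \<Rightarrow> 'm \<Rightarrow> 'm"  (infixr \<open>\<cdot>\<index>\<close> 70)

record ('o, 'm) preadd_cat = "('o, 'm) cat" +
  Add :: "'m \<Rightarrow> 'm \<Rightarrow> 'm"  (infixl \<open>\<oplus>\<index>\<close> 65)
  Zero :: "'o \<Rightarrow> 'o \<Rightarrow> 'm"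

definition Hom :: "('o, 'm, 'b) cat_scheme \<Rightarrow> 'o \<Rightarrow> 'o \<Rightarrow> 'm set"
  where "Hom C A B = {f \<in> Arr C. Dom C f = A \<and> Cod C f = B}"

text \<open>\<open>g \<cdot> f\<close> is the composite of \<open>f : A \<rightarrow> B\<close> followed by \<open>g : B \<rightarrow> D\<close>;
  its value is unconstrained if \<open>f\<close> and \<open>g\<close> are not composable.\<close>

locale category =
  fixes C :: "('o, 'm, 'b) cat_scheme" (structure)
  assumes dom_obj: "f \<in> Arr C \<Longrightarrow> Dom C f \<in> Obj C"
    and cod_obj: "f \<in> Arr C \<Longrightarrow> Cod C f \<in> Obj C"
    and ident_hom: "A \<in> Obj C \<Longrightarrow> Ident C A \<in> Hom C A A"
    and comp_hom: "\<lbrakk>f \<in> Hom C A B; g \<in> Hom C B D\<rbrakk> \<Longrightarrow> g \<cdot> f \<in> Hom C A D"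
    and comp_ident: "f \<in> Hom C A B \<Longrightarrow> f \<cdot> Ident C A = f"
    and ident_comp: "f \<in> Hom C A B \<Longrightarrow> Ident C B \<cdot> f = f"
    and comp_assoc: "\<lbrakk>f \<in> Hom C A B; g \<in> Hom C B D; h \<in> Hom C D F\<rbrakk>
      \<Longrightarrow> (h \<cdot> g) \<cdot> f = h \<cdot> (g \<cdot> f)"

definition hom_group :: "('o, 'm, 'b) preadd_cat_scheme \<Rightarrow> 'o \<Rightarrow> 'o \<Rightarrow> 'm monoid"
  where "hom_group C A B = \<lparr>carrier = Hom C A B, mult = Add C, one = Zero C A B\<rparr>"

locale preadditive_category = category C
  for C :: "('o, 'm, 'b) preadd_cat_scheme" (structure) +
  assumes hom_comm_group:
      "\<lbrakk>A \<in> Obj C; B \<in> Obj C\<rbrakk> \<Longrightarrow> comm_group (hom_group C A B)"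
    and comp_add_right: "\<lbrakk>f \<in> Hom C A B; f' \<in> Hom C A B; g \<in> Hom C B D\<rbrakk>
      \<Longrightarrow> g \<cdot> (f \<oplus> f') = (g \<cdot> f) \<oplus> (g \<cdot> f')"
    and comp_add_left: "\<lbrakk>f \<in> Hom C A B; g \<in> Hom C B D; g' \<in> Hom C B D\<rbrakk>
      \<Longrightarrow> (g \<oplus> g') \<cdot> f = (g \<cdot> f) \<oplus> (g' \<cdot> f)"

definition is_zero_object :: "('o, 'm, 'b) cat_scheme \<Rightarrow> 'o \<Rightarrow> bool"
  where "is_zero_object C N \<longleftrightarrow> N \<in> Obj C \<and>
    (\<forall>A\<in>Obj C. (\<exists>!f. f \<in> Hom C A N) \<and> (\<exists>!f. f \<in> Hom C N A))"

definition is_biproduct ::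
    "('o, 'm, 'b) preadd_cat_scheme \<Rightarrow> 'o \<Rightarrow> 'o \<Rightarrow> 'o \<Rightarrow> 'm \<Rightarrow> 'm \<Rightarrow> 'm \<Rightarrow> 'm \<Rightarrow> bool"
  where "is_biproduct C A B S i1 i2 p1 p2 \<longleftrightarrow>
    i1 \<in> Hom C A S \<and> i2 \<in> Hom C B S \<and> p1 \<in> Hom C S A \<and> p2 \<in> Hom C S B \<and>
    p1 \<cdot>\<^bsub>C\<^esub> i1 = Ident C A \<and> p2 \<cdot>\<^bsub>C\<^esub> i2 = Ident C B \<and>
    p1 \<cdot>\<^bsub>C\<^esub> i2 = Zero C B A \<and> p2 \<cdot>\<^bsub>C\<^esub> i1 = Zero C A B \<and>
    (i1 \<cdot>\<^bsub>C\<^esub> p1) \<oplus>\<^bsub>C\<^esub> (i2 \<cdot>\<^bsub>C\<^esub> p2) = Ident C S"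

locale additive_category = preadditive_category +
  assumes ex_zero_object: "\<exists>N. is_zero_object C N"
    and ex_biproduct: "\<lbrakk>A \<in> Obj C; B \<in> Obj C\<rbrakk>
      \<Longrightarrow> \<exists>S i1 i2 p1 p2. is_biproduct C A B S i1 i2 p1 p2"


section \<open>Isomorphisms, kernels, cokernels, pull-backs, push-outs\<close>

definition is_iso :: "('o, 'm, 'b) cat_scheme \<Rightarrow> 'm \<Rightarrow> bool"
  where "is_iso C f \<longleftrightarrow> f \<in> Arr C \<and>
    (\<exists>g \<in> Hom C (Cod C f) (Dom C f).
       g \<cdot>\<^bsub>C\<^esub> f = Ident C (Dom C f) \<and> f \<cdot>\<^bsub>C\<^esub> g = Ident C (Cod C f))"

text \<open>\<open>is_kernel C d i\<close>: the morphism \<open>i\<close> is a kernel of \<open>d\<close>;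
  \<open>is_cokernel C i d\<close>: the morphism \<open>d\<close> is a cokernel of \<open>i\<close>.\<close>

definition is_kernel :: "('o, 'm, 'b) preadd_cat_scheme \<Rightarrow> 'm \<Rightarrow> 'm \<Rightarrow> bool"
  where "is_kernel C d i \<longleftrightarrow>
    d \<in> Arr C \<and> i \<in> Arr C \<and> Cod C i = Dom C d \<and>
    d \<cdot>\<^bsub>C\<^esub> i = Zero C (Dom C i) (Cod C d) \<and>
    (\<forall>T\<in>Obj C. \<forall>t\<in>Hom C T (Dom C d). d \<cdot>\<^bsub>C\<^esub> t = Zero C T (Cod C d) \<longrightarrow>
       (\<exists>!h. h \<in> Hom C T (Dom C i) \<and> i \<cdot>\<^bsub>C\<^esub> h = t))"

definition is_cokernel :: "('o, 'm, 'b) preadd_cat_scheme \<Rightarrow> 'm \<Rightarrow> 'm \<Rightarrow> bool"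
  where "is_cokernel C i d \<longleftrightarrow>
    i \<in> Arr C \<and> d \<in> Arr C \<and> Dom C d = Cod C i \<and>
    d \<cdot>\<^bsub>C\<^esub> i = Zero C (Dom C i) (Cod C d) \<and>
    (\<forall>T\<in>Obj C. \<forall>t\<in>Hom C (Cod C i) T. t \<cdot>\<^bsub>C\<^esub> i = Zero C (Dom C i) T \<longrightarrow>
       (\<exists>!h. h \<in> Hom C (Cod C d) T \<and> h \<cdot>\<^bsub>C\<^esub> d = t))"

text \<open>\<open>is_pullback C g j i f\<close>: the pair of projections \<open>i : A \<rightarrow> Dom g\<close>, \<open>f : A \<rightarrow> Dom j\<close>
  is a pull-back of \<open>g\<close> and \<open>j\<close>, so that \<open>g \<cdot> i = j \<cdot> f\<close>.  Dually,
  \<open>is_pushout C i f l k\<close>: the pair \<open>l : Cod i \<rightarrow> P\<close>, \<open>k : Cod f \<rightarrow> P\<close>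
  is a push-out of \<open>i\<close> and \<open>f\<close>, so that \<open>l \<cdot> i = k \<cdot> f\<close>.\<close>

definition is_pullback :: "('o, 'm, 'b) cat_scheme \<Rightarrow> 'm \<Rightarrow> 'm \<Rightarrow> 'm \<Rightarrow> 'm \<Rightarrow> bool"
  where "is_pullback C g j i f \<longleftrightarrow>
    g \<in> Arr C \<and> j \<in> Arr C \<and> i \<in> Arr C \<and> f \<in> Arr C \<and>
    Cod C g = Cod C j \<and> Cod C i = Dom C g \<and> Cod C f = Dom C j \<and> Dom C i = Dom C f \<and>
    g \<cdot>\<^bsub>C\<^esub> i = j \<cdot>\<^bsub>C\<^esub> f \<and>
    (\<forall>T\<in>Obj C. \<forall>x\<in>Hom C T (Dom C g). \<forall>y\<in>Hom C T (Dom C j).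
       g \<cdot>\<^bsub>C\<^esub> x = j \<cdot>\<^bsub>C\<^esub> y \<longrightarrow>
       (\<exists>!h. h \<in> Hom C T (Dom C i) \<and> i \<cdot>\<^bsub>C\<^esub> h = x \<and> f \<cdot>\<^bsub>C\<^esub> h = y))"

definition is_pushout :: "('o, 'm, 'b) cat_scheme \<Rightarrow> 'm \<Rightarrow> 'm \<Rightarrow> 'm \<Rightarrow> 'm \<Rightarrow> bool"
  where "is_pushout C i f l k \<longleftrightarrow>
    i \<in> Arr C \<and> f \<in> Arr C \<and> l \<in> Arr C \<and> k \<in> Arr C \<and>
    Dom C i = Dom C f \<and> Dom C l = Cod C i \<and> Dom C k = Cod C f \<and> Cod C l = Cod C k \<and>
    l \<cdot>\<^bsub>C\<^esub> i = k \<cdot>\<^bsub>C\<^esub> f \<and>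
    (\<forall>T\<in>Obj C. \<forall>x\<in>Hom C (Cod C i) T. \<forall>y\<in>Hom C (Cod C f) T.
       x \<cdot>\<^bsub>C\<^esub> i = y \<cdot>\<^bsub>C\<^esub> f \<longrightarrow>
       (\<exists>!h. h \<in> Hom C (Cod C l) T \<and> h \<cdot>\<^bsub>C\<^esub> l = x \<and> h \<cdot>\<^bsub>C\<^esub> k = y))"


section \<open>Exact categories\<close>

definition admissible_monic :: "('m \<times> 'm) set \<Rightarrow> 'm \<Rightarrow> bool"
  where "admissible_monic E i \<longleftrightarrow> (\<exists>d. (i, d) \<in> E)"

definition admissible_epic :: "('m \<times> 'm) set \<Rightarrow> 'm \<Rightarrow> bool"
  where "admissible_epic E d \<longleftrightarrow> (\<exists>i. (i, d) \<in> E)"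

text \<open>Quillen's axioms in the form of Keller and Buehler: a class of kernel-cokernel pairs,
  closed under isomorphism, subject to (E0), (E1), (E2) and their duals.\<close>

locale exact_category = additive_category C
  for C :: "('o, 'm, 'b) preadd_cat_scheme" (structure) +
  fixes E :: "('m \<times> 'm) set"
  assumes kernel: "(i, d) \<in> E \<Longrightarrow> is_kernel C d i"
    and cokernel: "(i, d) \<in> E \<Longrightarrow> is_cokernel C i d"
    and iso_closed: "\<lbrakk>(i, d) \<in> E; i' \<in> Hom C A' B'; d' \<in> Hom C B' D';
        a \<in> Hom C (Dom C i) A'; b \<in> Hom C (Cod C i) B'; c \<in> Hom C (Cod C d) D';
        is_iso C a; is_iso C b; is_iso C c;
        b \<cdot> i = i' \<cdot> a; c \<cdot> d = d' \<cdot> b\<rbrakk> \<Longrightarrow> (i', d') \<in> E"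
    and E0: "A \<in> Obj C \<Longrightarrow> admissible_monic E (Ident C A)"
    and E0_op: "A \<in> Obj C \<Longrightarrow> admissible_epic E (Ident C A)"
    and E1: "\<lbrakk>admissible_monic E i; admissible_monic E j; Cod C i = Dom C j\<rbrakk>
      \<Longrightarrow> admissible_monic E (j \<cdot> i)"
    and E1_op: "\<lbrakk>admissible_epic E d; admissible_epic E e; Cod C d = Dom C e\<rbrakk>
      \<Longrightarrow> admissible_epic E (e \<cdot> d)"
    and E2: "\<lbrakk>admissible_monic E i; t \<in> Arr C; Dom C t = Dom C i\<rbrakk>
      \<Longrightarrow> (\<exists>l k. is_pushout C i t l k) \<and>
          (\<forall>l k. is_pushout C i t l k \<longrightarrow> admissible_monic E k)"
    and E2_op: "\<lbrakk>admissible_epic E d; t \<in> Arr C; Cod C t = Cod C d\<rbrakk>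
      \<Longrightarrow> (\<exists>p q. is_pullback C d t p q) \<and>
          (\<forall>p q. is_pullback C d t p q \<longrightarrow> admissible_epic E q)"


section \<open>AIS-categories\<close>

locale AIS_category = exact_category +
  assumes AIS_intersection:
      "\<lbrakk>admissible_monic E g; admissible_monic E j; Cod C g = Cod C j\<rbrakk>
      \<Longrightarrow> (\<exists>i f. is_pullback C g j i f) \<and>
          (\<forall>i f. is_pullback C g j i f \<longrightarrow> admissible_monic E i \<and> admissible_monic E f)"
    and AIS_sum:
      "\<lbrakk>admissible_monic E g; admissible_monic E j; is_pullback C g j i f;
        is_pushout C i f l k; u \<in> Hom C (Cod C l) (Cod C g); u \<cdot> l = g; u \<cdot> k = j\<rbrakk>
      \<Longrightarrow> admissible_monic E u"

text \<open>\<open>(A, i)\<close> is an \<open>E\<close>-subobject of \<open>Z\<close>.\<close>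

definition is_subobject ::
    "('o, 'm, 'b) cat_scheme \<Rightarrow> ('m \<times> 'm) set \<Rightarrow> 'o \<Rightarrow> 'o \<times> 'm \<Rightarrow> bool"
  where "is_subobject C E Z = (\<lambda>(A, i). i \<in> Hom C A Z \<and> admissible_monic E i)"

text \<open>Intersection and sum are determined only up to isomorphism, so they are given as
  relations.  \<open>is_intersection C (X1, i1) (X2, i2) P p1 p2\<close>: the object \<open>P\<close> with projections
  \<open>p1 : P \<rightarrow> X1\<close>, \<open>p2 : P \<rightarrow> X2\<close> is an intersection of the two subobjects.
  \<open>is_sum C (X1, i1) (X2, i2) S s1 s2\<close>: the object \<open>S\<close> with \<open>s1 : X1 \<rightarrow> S\<close>, \<open>s2 : X2 \<rightarrow> S\<close>
  is a sum, that is, a push-out of the projections of an intersection (by uniqueness up to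
  isomorphism it does not matter of which one).\<close>

definition is_intersection ::
    "('o, 'm, 'b) cat_scheme \<Rightarrow> 'o \<times> 'm \<Rightarrow> 'o \<times> 'm \<Rightarrow> 'o \<Rightarrow> 'm \<Rightarrow> 'm \<Rightarrow> bool"
  where "is_intersection C = (\<lambda>(X1, i1) (X2, i2) P p1 p2.
    p1 \<in> Hom C P X1 \<and> p2 \<in> Hom C P X2 \<and> is_pullback C i1 i2 p1 p2)"

definition is_sum ::
    "('o, 'm, 'b) cat_scheme \<Rightarrow> 'o \<times> 'm \<Rightarrow> 'o \<times> 'm \<Rightarrow> 'o \<Rightarrow> 'm \<Rightarrow> 'm \<Rightarrow> bool"
  where "is_sum C = (\<lambda>(X1, i1) (X2, i2) S s1 s2.
    s1 \<in> Hom C X1 S \<and> s2 \<in> Hom C X2 S \<and>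
    (\<exists>P p1 p2. is_intersection C (X1, i1) (X2, i2) P p1 p2 \<and> is_pushout C p1 p2 s1 s2))"

end

theory Submission
  imports Defs
begin

text \<open>In a push-out square \<open>a \<cdot> p = b \<cdot> q\<close>, a morphism \<open>t\<close> with \<open>t \<cdot> p = 0\<close> is the same as a
  morphism out of the push-out that vanishes on \<open>b\<close>; hence if \<open>c\<close> is a cokernel of \<open>b\<close>, then
  \<open>c \<cdot> a\<close> is a cokernel of \<open>p\<close>.  Here \<open>p\<close> is an admissible monic by the
  first half of (AIS), so it belongs to some \<open>(p, d) \<in> E\<close>; the cokernels \<open>d\<close> and \<open>c \<cdot> a\<close> differ by an
  isomorphism, under which \<open>E\<close> is closed.\<close>

lemma (in category) Hom_obj:
  assumes "f \<in> Hom C A B"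
  shows "A \<in> Obj C" "B \<in> Obj C"
  using assms dom_obj cod_obj by (auto simp: Hom_def)

lemma (in category) is_iso_Ident:
  assumes "A \<in> Obj C"
  shows "is_iso C (Ident C A)"
  using ident_hom[OF assms] comp_ident[OF ident_hom[OF assms]]
  unfolding is_iso_def by (auto simp: Hom_def)

lemma (in preadditive_category) zero_hom:
  assumes "A \<in> Obj C" "B \<in> Obj C"
  shows "Zero C A B \<in> Hom C A B"
proof -
  interpret H: comm_group "hom_group C A B" using assms by (rule hom_comm_group)
  show ?thesis using H.one_closed by (simp add: hom_group_def)
qed

text \<open>Cancellation in the group \<open>Hom C A B\<close>. This is how composites with zero
  morphisms are shown to vanish: additivity of composition together with 0 + 0 = 0 makes such a
  composite equal to its own double.\<close>

lemma (in preadditive_category) add_idem_imp_zero: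
  assumes "f \<in> Hom C A B" "f \<oplus> f = f"
  shows "f = Zero C A B"
proof -
  interpret H: comm_group "hom_group C A B" using assms(1) Hom_obj hom_comm_group by blast
  have "f = \<one>\<^bsub>hom_group C A B\<^esub>"
    using assms H.r_cancel_one[of f f] by (simp add: hom_group_def)
  then show ?thesis by (simp add: hom_group_def)
qed

lemma (in preadditive_category) zero_add_zero:
  assumes "A \<in> Obj C" "B \<in> Obj C"
  shows "Zero C A B \<oplus> Zero C A B = Zero C A B"
proof -
  interpret H: comm_group "hom_group C A B" using assms by (rule hom_comm_group)
  show ?thesis using H.l_one[OF H.one_closed] by (simp add: hom_group_def)
qed

lemma (in preadditive_category) zero_comp:
  assumes f: "f \<in> Hom C A B" and D: "D \<in> Obj C"
  shows "Zero C B D \<cdot> f = Zero C A D"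
proof (rule add_idem_imp_zero)
  have z: "Zero C B D \<in> Hom C B D" using f D Hom_obj zero_hom by blast
  show "Zero C B D \<cdot> f \<in> Hom C A D" using f z by (rule comp_hom)
  show "(Zero C B D \<cdot> f) \<oplus> (Zero C B D \<cdot> f) = Zero C B D \<cdot> f"
    using comp_add_left[OF f z z] zero_add_zero[OF Hom_obj(2)[OF f] D] by simp
qed

lemma (in preadditive_category) comp_zero:
  assumes g: "g \<in> Hom C B D" and A: "A \<in> Obj C"
  shows "g \<cdot> Zero C A B = Zero C A D"
proof (rule add_idem_imp_zero)
  have z: "Zero C A B \<in> Hom C A B" using g A Hom_obj zero_hom by blast
  show "g \<cdot> Zero C A B \<in> Hom C A D" using z g by (rule comp_hom)
  show "(g \<cdot> Zero C A B) \<oplus> (g \<cdot> Zero C A B) = g \<cdot> Zero C A B"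
    using comp_add_right[OF z z g] zero_add_zero[OF A Hom_obj(1)[OF g]] by simp
qed

text \<open>Two pull-backs of the same pair are linked by comparison morphisms in both directions
  that commute with the projections, so a pair of morphisms equalises one span exactly when it
  equalises the other. This is needed because \<open>is_sum\<close> may come from a different
  intersection than the given one.\<close>

lemma (in category) pushout_change_pullback:
  assumes pb: "is_pullback C g j p q" and pb': "is_pullback C g j p' q'"
    and po: "is_pushout C p' q' a b"
  shows "is_pushout C p q a b"
proof -
  let ?P = "Dom C p" and ?P' = "Dom C p'" and ?A = "Dom C g" and ?B = "Dom C j" and ?S = "Cod C a"
  have p: "p \<in> Hom C ?P ?A" "q \<in> Hom C ?P ?B" and sq: "g \<cdot> p = j \<cdot> q"
    using pb by (auto simp: is_pullback_def Hom_def)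
  have p': "p' \<in> Hom C ?P' ?A" "q' \<in> Hom C ?P' ?B" and sq': "g \<cdot> p' = j \<cdot> q'"
    using pb' by (auto simp: is_pullback_def Hom_def)
  have a: "a \<in> Hom C ?A ?S" "b \<in> Hom C ?B ?S" and po_sq: "a \<cdot> p' = b \<cdot> q'"
    using po p' by (auto simp: is_pushout_def Hom_def)
  obtain h where h: "h \<in> Hom C ?P ?P'" "p' \<cdot> h = p" "q' \<cdot> h = q"
    using pb' p sq Hom_obj(1)[OF p(1)] unfolding is_pullback_def by metis
  obtain h' where h': "h' \<in> Hom C ?P' ?P" "p \<cdot> h' = p'" "q \<cdot> h' = q'"
    using pb p' sq' Hom_obj(1)[OF p'(1)] unfolding is_pullback_def by metis
  \<comment> \<open>Precompose the square over \<open>p'\<close>, \<open>q'\<close> with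
    \<open>h\<close>.\<close>
  have "a \<cdot> p = b \<cdot> q"
    using comp_assoc[OF h(1) p'(1) a(1)] comp_assoc[OF h(1) p'(2) a(2)] h po_sq by simp
  moreover have "\<exists>!k. k \<in> Hom C ?S T \<and> k \<cdot> a = x \<and> k \<cdot> b = y"
    if T: "T \<in> Obj C" and x: "x \<in> Hom C ?A T" and y: "y \<in> Hom C ?B T" and e: "x \<cdot> p = y \<cdot> q" for T x y
  proof -
    \<comment> \<open>Precomposing with \<open>h'\<close> turns a test pair for \<open>p\<close>,
      \<open>q\<close> into one for \<open>p'\<close>, \<open>q'\<close>, where the given push-out
      applies.\<close>
    have "x \<cdot> p' = y \<cdot> q'"
      using comp_assoc[OF h'(1) p(1) x] comp_assoc[OF h'(1) p(2) y] h' e by simp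
    moreover have "Cod C p' = ?A" "Cod C q' = ?B" using p' by (auto simp: Hom_def)
    ultimately show ?thesis
      using po T x y unfolding is_pushout_def by metis
  qed
  moreover have "Cod C p = ?A" "Cod C q = ?B" "p \<in> Arr C" "q \<in> Arr C" "a \<in> Arr C" "b \<in> Arr C"
      "Dom C p = Dom C q" "Dom C a = ?A" "Dom C b = ?B" "Cod C b = ?S"
    using p a by (auto simp: Hom_def)
  ultimately show ?thesis
    unfolding is_pushout_def by simp
qed

lemma (in preadditive_category) pushout_cokernel:
  assumes po: "is_pushout C p q a b" and coker: "is_cokernel C b c"
  shows "is_cokernel C p (c \<cdot> a)"
proof -
  let ?P = "Dom C p" and ?A = "Cod C p" and ?B = "Cod C q" and ?S = "Cod C a" and ?Q = "Cod C c"
  have p: "p \<in> Hom C ?P ?A" and q: "q \<in> Hom C ?P ?B"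
    and a: "a \<in> Hom C ?A ?S" and b: "b \<in> Hom C ?B ?S" and sq: "a \<cdot> p = b \<cdot> q"
    using po by (auto simp: is_pushout_def Hom_def)
  have c: "c \<in> Hom C ?S ?Q" and cb: "c \<cdot> b = Zero C ?B ?Q"
    using coker b by (auto simp: is_cokernel_def Hom_def)
  have ca: "c \<cdot> a \<in> Hom C ?A ?Q" using a c by (rule comp_hom)
  have cap: "(c \<cdot> a) \<cdot> p = Zero C ?P ?Q"
    using comp_assoc[OF p a c] comp_assoc[OF q b c] sq cb zero_comp[OF q Hom_obj(2)[OF c]] by metis
  have factor: "\<exists>!h. h \<in> Hom C ?Q T \<and> h \<cdot> (c \<cdot> a) = t"
    if T: "T \<in> Obj C" and t: "t \<in> Hom C ?A T" and tp: "t \<cdot> p = Zero C ?P T" for T t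
  proof -
    \<comment> \<open>The zero morphism on \<open>?B\<close> is the partner of \<open>t\<close>: the
      two together form a test pair for the push-out, and the induced \<open>k\<close> kills
      \<open>b\<close>, hence factors through \<open>c\<close>.\<close>
    have z: "Zero C ?B T \<in> Hom C ?B T" using q T Hom_obj zero_hom by blast
    have "t \<cdot> p = Zero C ?B T \<cdot> q" using tp zero_comp[OF q T] by simp
    then have ex1: "\<exists>!k. k \<in> Hom C ?S T \<and> k \<cdot> a = t \<and> k \<cdot> b = Zero C ?B T"
      using po T t z unfolding is_pushout_def by blast
    then obtain k where k: "k \<in> Hom C ?S T" "k \<cdot> a = t" "k \<cdot> b = Zero C ?B T" by blast
    then have ex1': "\<exists>!h. h \<in> Hom C ?Q T \<and> h \<cdot> c = k"
      using coker T b unfolding is_cokernel_def by (auto simp: Hom_def)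
    then obtain h where h: "h \<in> Hom C ?Q T" "h \<cdot> c = k" by blast
    show ?thesis
    proof (intro ex1I[of _ h] conjI)
      show "h \<in> Hom C ?Q T" by (rule h(1))
      show "h \<cdot> (c \<cdot> a) = t" using comp_assoc[OF a c h(1)] h k by simp
      fix h' assume h': "h' \<in> Hom C ?Q T \<and> h' \<cdot> (c \<cdot> a) = t"
      then have hom: "h' \<in> Hom C ?Q T" by blast
      \<comment> \<open>Uniqueness takes two stages: \<open>h' \<cdot> c\<close> satisfies the
        conditions that determine \<open>k\<close> on the push-out, and then factorisations of
        \<open>k\<close> through \<open>c\<close> are unique.\<close>
      have "h' \<cdot> c \<in> Hom C ?S T" using c hom by (rule comp_hom)
      moreover have "(h' \<cdot> c) \<cdot> a = t" using comp_assoc[OF a c hom] h' by simp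
      moreover have "(h' \<cdot> c) \<cdot> b = Zero C ?B T"
        using comp_assoc[OF b c hom] cb comp_zero[OF hom Hom_obj(1)[OF b]] by simp
      ultimately have "h' \<cdot> c = k" using ex1 k by blast
      then show "h' = h" using ex1' hom h by blast
    qed
  qed
  have "Dom C (c \<cdot> a) = ?A" "Cod C (c \<cdot> a) = ?Q" "c \<cdot> a \<in> Arr C" "p \<in> Arr C"
    using ca p by (auto simp: Hom_def)
  then show ?thesis
    using cap factor unfolding is_cokernel_def by simp
qed

lemma (in preadditive_category) cokernel_unique:
  assumes d: "is_cokernel C i d" and e: "is_cokernel C i e"
  shows "\<exists>w\<in>Hom C (Cod C d) (Cod C e). is_iso C w \<and> w \<cdot> d = e"
proof -
  let ?B = "Cod C i" and ?D = "Cod C d" and ?F = "Cod C e"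
  have dh: "d \<in> Hom C ?B ?D" and eh: "e \<in> Hom C ?B ?F"
    using d e by (auto simp: is_cokernel_def Hom_def)
  note obj = Hom_obj[OF dh] Hom_obj[OF eh]
  obtain w where w: "w \<in> Hom C ?D ?F" "w \<cdot> d = e"
    using d e eh obj unfolding is_cokernel_def by metis
  obtain v where v: "v \<in> Hom C ?F ?D" "v \<cdot> e = d"
    using d e dh obj unfolding is_cokernel_def by metis
  \<comment> \<open>Both \<open>v \<cdot> w\<close> and the identity factor \<open>d\<close> through
    itself, so they agree; the same argument with \<open>e\<close> handles
    \<open>w \<cdot> v\<close>.\<close>
  have "\<exists>!h. h \<in> Hom C ?D ?D \<and> h \<cdot> d = d"
    using d dh obj unfolding is_cokernel_def by blast
  moreover have "(v \<cdot> w) \<cdot> d = d" using comp_assoc[OF dh w(1) v(1)] w v by simp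
  moreover have "v \<cdot> w \<in> Hom C ?D ?D" using w(1) v(1) by (rule comp_hom)
  ultimately have vw: "v \<cdot> w = Ident C ?D"
    using ident_hom[OF obj(2)] ident_comp[OF dh] by blast
  have "\<exists>!h. h \<in> Hom C ?F ?F \<and> h \<cdot> e = e"
    using e eh obj unfolding is_cokernel_def by blast
  moreover have "(w \<cdot> v) \<cdot> e = e" using comp_assoc[OF eh v(1) w(1)] w v by simp
  moreover have "w \<cdot> v \<in> Hom C ?F ?F" using v(1) w(1) by (rule comp_hom)
  ultimately have wv: "w \<cdot> v = Ident C ?F"
    using ident_hom[OF obj(4)] ident_comp[OF eh] by blast
  have "is_iso C w" using w(1) v(1) vw wv unfolding is_iso_def by (auto simp: Hom_def)
  then show ?thesis using w by blast
qed

text \<open>Admissibility of \<open>i\<close> supplies only some partner in \<open>E\<close>; a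
  prescribed cokernel replaces it by closure under isomorphism, with identities on the two objects
  of \<open>i\<close> and the comparison of cokernels as third component.\<close>

lemma (in exact_category) admissible_monic_cokernel:
  assumes "admissible_monic E i" and e: "is_cokernel C i e"
  shows "(i, e) \<in> E"
proof -
  obtain d where d: "(i, d) \<in> E" using assms(1) unfolding admissible_monic_def by blast
  obtain w where w: "w \<in> Hom C (Cod C d) (Cod C e)" "is_iso C w" "w \<cdot> d = e"
    using cokernel_unique[OF cokernel[OF d] e] by blast
  have i: "i \<in> Hom C (Dom C i) (Cod C i)" and eh: "e \<in> Hom C (Cod C i) (Cod C e)"
    using e by (auto simp: is_cokernel_def Hom_def)
  note obj = Hom_obj[OF i]
  show ?thesis
    using iso_closed[OF d i eh ident_hom[OF obj(1)] ident_hom[OF obj(2)] w(1)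
        is_iso_Ident[OF obj(1)] is_iso_Ident[OF obj(2)] w(2)]
      comp_ident[OF i] ident_comp[OF i] comp_ident[OF eh] w(3) by simp
qed

theorem lemma5p2:
  fixes C :: "('o, 'm, 'b) preadd_cat_scheme"
    and E :: "('m \<times> 'm) set"
    and X Y' Y'' Z P S Q :: 'o
    and iX iY' iY'' m p q a b c :: 'm
  assumes "AIS_category C E"
    and "is_subobject C E Z (X, iX)"
    and "is_subobject C E Z (Y', iY')"
    and "is_subobject C E Z (Y'', iY'')"
    and "m \<in> Hom C Y' Y''" and "admissible_monic E m" and "Comp C iY'' m = iY'"
    and "is_intersection C (Y', iY') (X, iX) P p q"
    and "is_sum C (Y', iY') (X, iX) S a b"
    and "c \<in> Hom C S Q" and "is_cokernel C b c"
  shows "(p, Comp C c a) \<in> E"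
proof -
  interpret AIS_category C E by fact
  have pb: "is_pullback C iY' iX p q"
    using assms(8) by (simp add: is_intersection_def)
  \<comment> \<open>The intersection behind the sum need not be the given \<open>P\<close>, so its
    push-out square is first transported to \<open>p\<close>, \<open>q\<close>.\<close>
  obtain p' q' where "is_pullback C iY' iX p' q'" "is_pushout C p' q' a b"
    using assms(9) by (auto simp: is_sum_def is_intersection_def)
  with pb have "is_pushout C p q a b" by (rule pushout_change_pullback)
  then have "is_cokernel C p (Comp C c a)" using assms(11) by (rule pushout_cokernel)
  moreover have "admissible_monic E p"
  proof -
    have "admissible_monic E iY'" "admissible_monic E iX"
      using assms(2,3) by (auto simp: is_subobject_def)
    moreover have "Cod C iY' = Cod C iX" using pb by (simp add: is_pullback_def)
    ultimately show ?thesis using AIS_intersection pb by blast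
  qed
  ultimately show ?thesis by (intro admissible_monic_cokernel)
qed

end
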